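(* Let $n\ge 1$, $m\ge 0$ and $\delta\ge 0$ be integers with $2m+1\ge\delta$, put $D:=2m+1-\delta$, and let $\mathrm{w}$ be a weight function on $(a,b)$ together with quadrature rules (nodes $x^{(M+1)}_l$ and weights $\mathrm{w}^{(M+1)}_l$, $0\le l\le M$) that are exact in degree at most $2M+1-\delta$, as described in the context. Then for every symmetric polynomial $f(\mathbf{x})\in\mathbb{P}^{(D,n)}$ one has $$\frac{1}{n!}\int_a^b\cdots\int_a^b f(\mathbf{x})\,\mathrm{W}^{(n)}(\mathbf{x})\,\mathrm{d}x_1\cdots\mathrm{d}x_n=\sum_{\lambda\in\Lambda^{(m,n)}} f\bigl(\mathbf{x}^{(m,n)}_\lambda\bigr)\,\mathrm{W}^{(m,n)}_\lambda ,$$ where $$\mathrm{W}^{(n)}(\mathbf{x}):=\prod_{1\le j<k\le n}(x_j-x_k)^2\prod_{1\le j\le n}\mathrm{w}(x_j),$$ $$\mathbf{x}^{(m,n)}_\lambda:=\Bigl(x^{(m+n)}_{\lambda_1+n-1},\,x^{(m+n)}_{\lambda_2+n-2},\ldots,x^{(m+n)}_{\lambda_{n-1}+1},\,x^{(m+n)}_{\lambda_n}\Bigr),$$ $$\mathrm{W}^{(m,n)}_\lambda:=\prod_{1\le j<k\le n}\Bigl(x^{(m+n)}_{\lambda_j+n-j}-x^{(m+n)}_{\lambda_k+n-k}\Bigr)^2\prod_{1\le j\le n}\mathrm{w}^{(m+n)}_{\lambda_j+n-j},$$ and the summation is over the $\binom{m+n}{n}$ nodes labeled by $$\Lambda^{(m,n)}:=\{\lambda=(\lambda_1,\ldots,\lambda_n)\in\mathbb{Z}^n\mid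 m\ge\lambda_1\ge\lambda_2\ge\cdots\ge\lambda_n\ge 0\}.$$
   Context: Setting. $\mathrm{w}(x)$, $a<x<b$, is a (real-valued, measurable) weight function with finite moments $\int_a^b x^k\,\mathrm{w}(x)\,\mathrm{d}x$ ($k=0,1,2,\ldots$), the moment integrals converging absolutely. Here $a<b$ are real numbers; the values $a=-\infty$ and/or $b=+\infty$ are also allowed, provided all moment integrals converge in absolute value. The weight function is not assumed to be positive. Quadrature rules. A fixed integer constant $\delta\ge 0$ is given. For each nonnegative integer $M$ with $2M+1\ge\delta$ one is given real nodes $a\le x^{(M+1)}_0<x^{(M+1)}_1<\cdots<x^{(M+1)}_M\le b$ and real weights $\mathrm{w}^{(M+1)}_0,\ldots,\mathrm{w}^{(M+1)}_M$ (not assumed positive) such that the rule $$\int_a^b f(x)\,\mathrm{w}(x)\,\mathrm{d}x=\sum_{0\le l\le M} f\bigl(x^{(M+1)}_l\bigr)\,\mathrm{w}^{(M+1)}_l$$ holds for all polynomials $f(x)$ in one variable of degree at most $2M+1-\delta$. The constant $\delta$ does not depend on $M$. The superscript counts the nodes, so $x^{(m+n)}_l$ and $\mathrm{w}^{(m+n)}_l$, $0\le l\le m+n-1$, are the nodes and weights of the rule with $m+n$ nodes (the case $M=m+n-1$). Polynomial space. For an integer $D\ge 0$, $\mathbb{P}^{(D,n)}$ denotes the $\binom{D+n}{n}$-dimensional space of symmetric polynomials in $\mathbf{x}=(x_1,\ldots,x_n)$ that are of degree at most $D$ in each of the variables $x_j$ ($j=1,\ldots,n$). *)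

theory Defs
  imports
    "HOL-Analysis.Analysis"
    "HOL-Combinatorics.Permutations"
    "HOL-Library.Poly_Mapping"
begin

(* A polynomial in the variables x_1, x_2, ... is a finitely supported map from exponent vectors
   to coefficients; an exponent vector is itself a finitely supported map on the variable indices. *)
type_synonym mpoly_real = "(nat \<Rightarrow>\<^sub>0 nat) \<Rightarrow>\<^sub>0 real"

definition mpoly_eval :: "mpoly_real \<Rightarrow> (nat \<Rightarrow> real) \<Rightarrow> real" where
  "mpoly_eval f x =
     (\<Sum>\<mu>\<in>Poly_Mapping.keys f.
        Poly_Mapping.lookup f \<mu> * (\<Prod>j\<in>Poly_Mapping.keys \<mu>. x j ^ Poly_Mapping.lookup \<mu> j))"

(* f is invariant under x_1, ..., x_n |-> x_(\<sigma> 1), ..., x_(\<sigma> n). Since map_key \<sigma> \<mu> has j-th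
   exponent \<mu>_(\<sigma> j), this is invariance of the coefficients along orbits of monomials. *)
definition symmetric_mpoly :: "nat \<Rightarrow> mpoly_real \<Rightarrow> bool" where
  "symmetric_mpoly n f \<longleftrightarrow>
     (\<forall>\<sigma>. \<sigma> permutes {1..n} \<longrightarrow>
        (\<forall>\<mu>. Poly_Mapping.lookup f (Poly_Mapping.map_key \<sigma> \<mu>) = Poly_Mapping.lookup f \<mu>))"

definition sym_poly_space :: "nat \<Rightarrow> nat \<Rightarrow> mpoly_real set" where
  "sym_poly_space D n =
     {f. symmetric_mpoly n f \<and>
         (\<forall>\<mu>\<in>Poly_Mapping.keys f. Poly_Mapping.keys \<mu> \<subseteq> {1..n} \<and>
            (\<forall>j\<in>{1..n}. Poly_Mapping.lookup \<mu> j \<le> D))}"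

definition weight_function :: "ereal \<Rightarrow> ereal \<Rightarrow> (real \<Rightarrow> real) \<Rightarrow> bool" where
  "weight_function a b w \<longleftrightarrow>
     set_borel_measurable lebesgue (einterval a b) w \<and>
     (\<forall>k::nat. interval_lebesgue_integrable lebesgue a b (\<lambda>x. x ^ k * w x))"

(* nd N l and wt N l (0 \<le> l < N) are the nodes and weights of the rule with N nodes; nothing is
   required of them outside this range or when N = M + 1 with 2 M + 1 < \<delta>. *)
definition quadrature_rules ::
  "ereal \<Rightarrow> ereal \<Rightarrow> (real \<Rightarrow> real) \<Rightarrow> nat \<Rightarrow> (nat \<Rightarrow> nat \<Rightarrow> real) \<Rightarrow> (nat \<Rightarrow> nat \<Rightarrow> real) \<Rightarrow> bool"
where
  "quadrature_rules a b w \<delta> nd wt \<longleftrightarrow>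
     (\<forall>M. \<delta> \<le> 2 * M + 1 \<longrightarrow>
        (\<forall>l\<in>{0..M}. a \<le> ereal (nd (M + 1) l) \<and> ereal (nd (M + 1) l) \<le> b) \<and>
        strict_mono_on {0..M} (nd (M + 1)) \<and>
        (\<forall>f::real poly. degree f \<le> 2 * M + 1 - \<delta> \<longrightarrow>
           (LINT x=a..b|lebesgue. (poly f x * w x)) =
           (\<Sum>l=0..M. poly f (nd (M + 1) l) * wt (M + 1) l)))"

definition W_density :: "(real \<Rightarrow> real) \<Rightarrow> nat \<Rightarrow> (nat \<Rightarrow> real) \<Rightarrow> real" where
  "W_density w n x =
     (\<Prod>k\<in>{1..n}. \<Prod>j\<in>{1..<k}. (x j - x k)\<^sup>2) * (\<Prod>j\<in>{1..n}. w (x j))"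

definition partitions_box :: "nat \<Rightarrow> nat \<Rightarrow> (nat \<Rightarrow> nat) set" where
  "partitions_box m n =
     {la \<in> {1..n} \<rightarrow>\<^sub>E {0..m}. \<forall>j\<in>{1..<n}. la (j + 1) \<le> la j}"

definition cub_node :: "(nat \<Rightarrow> nat \<Rightarrow> real) \<Rightarrow> nat \<Rightarrow> nat \<Rightarrow> (nat \<Rightarrow> nat) \<Rightarrow> nat \<Rightarrow> real" where
  "cub_node nd m n la = (\<lambda>j\<in>{1..n}. nd (m + n) (la j + (n - j)))"

definition cub_weight ::
  "(nat \<Rightarrow> nat \<Rightarrow> real) \<Rightarrow> (nat \<Rightarrow> nat \<Rightarrow> real) \<Rightarrow> nat \<Rightarrow> nat \<Rightarrow> (nat \<Rightarrow> nat) \<Rightarrow> real" where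
  "cub_weight nd wt m n la =
     (\<Prod>k\<in>{1..n}. \<Prod>j\<in>{1..<k}.
        (nd (m + n) (la j + (n - j)) - nd (m + n) (la k + (n - k)))\<^sup>2) *
     (\<Prod>j\<in>{1..n}. wt (m + n) (la j + (n - j)))"

end

theory Submission
  imports Defs
begin

text \<open>The squared Vandermonde determinant has degree \<open>2 (n - 1)\<close> in each variable, so its product
  with \<open>f\<close> has degree at most \<open>2 (m + n - 1) + 1 - \<delta>\<close> in each variable and is integrated exactly by
  the \<open>n\<close>-fold tensor power of the rule with \<open>m + n\<close> nodes. The resulting sum over all maps from
  \<open>{1..n}\<close> to the node indices has symmetric summands that vanish at non-injective maps. Every
  injective map is, for a unique permutation, a rearrangement of a unique strictly decreasing one,
  and the strictly decreasing ones are \<open>j \<mapsto> la j + (n - j)\<close> with \<open>la\<close> a partition in the box.\<close>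

section \<open>Polynomials with a degree bound in each variable\<close>

text \<open>For finite \<open>I\<close> these are the polynomial functions of degree at most
  \<open>d j\<close> in \<open>x j\<close>. They are generated as linear combinations of products of
  univariate polynomials, so that rule induction reduces linear identities to such products, where
  Fubini applies.\<close>

inductive tensor_poly :: "'i set \<Rightarrow> ('i \<Rightarrow> nat) \<Rightarrow> (('i \<Rightarrow> real) \<Rightarrow> real) \<Rightarrow> bool"
  for I :: "'i set" and d :: "'i \<Rightarrow> nat" where
  prod: "(\<And>j. j \<in> I \<Longrightarrow> degree (p j) \<le> d j) \<Longrightarrow> tensor_poly I d (\<lambda>x. \<Prod>j\<in>I. poly (p j) (x j))"
| scale: "tensor_poly I d g \<Longrightarrow> tensor_poly I d (\<lambda>x. c * g x)"
| add: "tensor_poly I d g \<Longrightarrow> tensor_poly I d h \<Longrightarrow> tensor_poly I d (\<lambda>x. g x + h x)"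

lemma tensor_poly_mono:
  assumes "tensor_poly I d g" and "\<And>j. j \<in> I \<Longrightarrow> d j \<le> e j"
  shows "tensor_poly I e g"
  using assms
proof (induction rule: tensor_poly.induct)
  case (prod p)
  then show ?case by (intro tensor_poly.prod) (meson le_trans)
qed (auto intro: tensor_poly.intros)

lemma tensor_poly_const: "tensor_poly I d (\<lambda>x. c)"
proof -
  have "tensor_poly I d (\<lambda>x. c * (\<Prod>j\<in>I. poly 1 (x j)))"
    by (intro tensor_poly.scale tensor_poly.prod) auto
  then show ?thesis by simp
qed

lemma tensor_poly_var:
  assumes "finite I" "k \<in> I"
  shows "tensor_poly I (\<lambda>i. if i = k then 1 else 0) (\<lambda>x. x k)"
proof -
  have "tensor_poly I (\<lambda>i. if i = k then 1 else 0)
          (\<lambda>x. \<Prod>j\<in>I. poly (if j = k then [:0, 1:] else 1) (x j))"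
    by (rule tensor_poly.prod) auto
  moreover have "(\<Prod>j\<in>I. poly (if j = k then [:0, 1:] else 1) (x j)) = x k" for x :: "'a \<Rightarrow> real"
  proof -
    have "(\<Prod>j\<in>I. poly (if j = k then [:0, 1:] else 1) (x j)) = (\<Prod>j\<in>I. if j = k then x j else 1)"
      by (intro prod.cong) auto
    then show ?thesis using assms by simp
  qed
  ultimately show ?thesis by simp
qed

lemma tensor_poly_sum:
  assumes "\<And>i. i \<in> A \<Longrightarrow> tensor_poly I d (g i)"
  shows "tensor_poly I d (\<lambda>x. \<Sum>i\<in>A. g i x)"
  using assms
  by (induction A rule: infinite_finite_induct) (auto intro: tensor_poly_const tensor_poly.add)

text \<open>By bilinearity a double induction leaves only two products, whose univariate factors
  multiply index by index and add their degrees.\<close>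

lemma tensor_poly_mult:
  assumes "tensor_poly I d g" "tensor_poly I e h"
  shows "tensor_poly I (\<lambda>j. d j + e j) (\<lambda>x. g x * h x)"
  using assms(1)
proof (induction rule: tensor_poly.induct)
  case (prod p)
  from assms(2) show ?case
  proof (induction rule: tensor_poly.induct)
    case (prod q)
    have "tensor_poly I (\<lambda>j. d j + e j) (\<lambda>x. \<Prod>j\<in>I. poly (p j * q j) (x j))"
      using \<open>\<And>j. j \<in> I \<Longrightarrow> degree (p j) \<le> d j\<close> prod
      by (intro tensor_poly.prod) (meson add_mono degree_mult_le le_trans)
    then show ?case by (simp add: prod.distrib)
  next
    case (scale h c)
    from tensor_poly.scale[OF scale.IH, of c] show ?case by (simp add: mult.left_commute)
  next
    case (add g h)
    from tensor_poly.add[OF add.IH] show ?case by (simp add: distrib_left)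
  qed
next
  case (scale g c)
  from tensor_poly.scale[OF scale.IH, of c] show ?case by (simp add: mult.assoc)
next
  case (add g h)
  from tensor_poly.add[OF add.IH] show ?case by (simp add: distrib_right)
qed

lemma tensor_poly_prod:
  assumes "\<And>i. i \<in> A \<Longrightarrow> tensor_poly I (d i) (g i)"
  shows "tensor_poly I (\<lambda>j. \<Sum>i\<in>A. d i j) (\<lambda>x. \<Prod>i\<in>A. g i x)"
  using assms
  by (induction A rule: infinite_finite_induct) (auto intro: tensor_poly_const tensor_poly_mult)

text \<open>The bound is twice the number of occurrences of \<open>i\<close> in the pair, so that
  summing it over all pairs yields the degree of the full product.\<close>

lemma tensor_poly_diff_sq:
  assumes "finite I" "j \<in> I" "k \<in> I"
  shows "tensor_poly I (\<lambda>i. 2 * ((if i = j then 1 else 0) + (if i = k then 1 else 0)))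
           (\<lambda>x. (x j - x k)\<^sup>2)"
proof -
  let ?d = "\<lambda>i. (if i = j then 1 else 0) + (if i = k then 1 else 0)"
  have "tensor_poly I ?d (\<lambda>x. x j + (-1) * x k)"
    by (intro tensor_poly.add tensor_poly.scale)
       (auto intro: tensor_poly_mono[OF tensor_poly_var[OF assms(1,2)]]
          tensor_poly_mono[OF tensor_poly_var[OF assms(1,3)]])
  from tensor_poly_mult[OF this this] show ?thesis
    unfolding mult_2 by (simp add: power2_eq_square)
qed

text \<open>The variable \<open>x i\<close> occurs in \<open>n - i\<close> pairs with the smaller
  index and in \<open>i - 1\<close> with the larger one. Each of these \<open>n - 1\<close> pairs
  contributes degree 2.\<close>

lemma tensor_poly_vandermonde_sq:
  "tensor_poly {1..n} (\<lambda>_. 2 * (n - 1)) (\<lambda>x. \<Prod>k\<in>{1..n}. \<Prod>j\<in>{1..<k}. (x j - x k)\<^sup>2)"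
proof -
  have *: "(\<Sum>k\<in>{1..n}. \<Sum>j\<in>{1..<k}. 2 * ((if i = j then 1 else 0) + (if i = k then 1 else 0)))
      = 2 * (n - 1)" if "i \<in> {1..n}" for i :: nat
  proof -
    have "(\<Sum>k\<in>{1..n}. \<Sum>j\<in>{1..<k}. if i = j then 1 else 0 :: nat) = (\<Sum>k\<in>{1..n}. if i < k then 1 else 0)"
      using that by (intro sum.cong) auto
    also have "\<dots> = (\<Sum>k\<in>{i<..n}. 1)"
      using that by (intro sum.mono_neutral_cong_right) auto
    finally have 1: "(\<Sum>k\<in>{1..n}. \<Sum>j\<in>{1..<k}. if i = j then 1 else 0) = n - i" by simp
    have "(\<Sum>k\<in>{1..n}. \<Sum>j\<in>{1..<k}. if i = k then 1 else 0) = (\<Sum>k\<in>{1..n}. if i = k then k - 1 else 0)"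
      by (intro sum.cong) auto
    then have 2: "(\<Sum>k\<in>{1..n}. \<Sum>j\<in>{1..<k}. if i = k then 1 else 0) = i - 1"
      using that by simp
    show ?thesis
      using that by (simp only: sum_distrib_left[symmetric] sum.distrib 1 2) auto
  qed
  have "tensor_poly {1..n}
     (\<lambda>i. \<Sum>k\<in>{1..n}. \<Sum>j\<in>{1..<k}. 2 * ((if i = j then 1 else 0) + (if i = k then 1 else 0)))
     (\<lambda>x. \<Prod>k\<in>{1..n}. \<Prod>j\<in>{1..<k}. (x j - x k)\<^sup>2)"
    by (intro tensor_poly_prod tensor_poly_diff_sq) auto
  then show ?thesis
    by (rule tensor_poly_mono) (simp only: *)
qed

section \<open>Tensor products of quadrature rules\<close>

text \<open>Both sides are linear in \<open>g\<close>. On a product of univariate polynomials the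
  integral factors by Fubini, the one-dimensional rule applies to each factor, and expanding the
  product of sums gives a sum over all index maps. Integrability is part of the induction because
  additivity of the integral requires it.\<close>

lemma tensor_quadrature:
  assumes "sigma_finite_measure M" and fin: "finite I" and "tensor_poly I (\<lambda>_. D) g"
    and int: "\<And>p. degree p \<le> D \<Longrightarrow> integrable M (\<lambda>t. v t * poly p t)"
    and exact: "\<And>p. degree p \<le> D \<Longrightarrow>
      (\<integral>t. v t * poly p t \<partial>M) = (\<Sum>l\<in>L. poly p (y l) * u l)"
    and L: "finite L"
  shows "integrable (Pi\<^sub>M I (\<lambda>_. M)) (\<lambda>x. (\<Prod>j\<in>I. v (x j)) * g x) \<and>
    (\<integral>x. (\<Prod>j\<in>I. v (x j)) * g x \<partial>Pi\<^sub>M I (\<lambda>_. M)) =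
    (\<Sum>l\<in>I \<rightarrow>\<^sub>E L. g (\<lambda>j. y (l j)) * (\<Prod>j\<in>I. u (l j)))"
  using assms(3)
proof (induction rule: tensor_poly.induct)
  case (prod p)
  interpret sigma_finite_measure M by fact
  interpret product_sigma_finite "\<lambda>_. M" by unfold_locales
  have "integrable (Pi\<^sub>M I (\<lambda>_. M)) (\<lambda>x. \<Prod>j\<in>I. v (x j) * poly (p j) (x j))"
    using prod int fin by (intro product_integrable_prod) auto
  moreover have "(\<integral>x. (\<Prod>j\<in>I. v (x j) * poly (p j) (x j)) \<partial>Pi\<^sub>M I (\<lambda>_. M))
      = (\<Prod>j\<in>I. \<integral>t. v t * poly (p j) t \<partial>M)"
    using prod int fin by (intro product_integral_prod) auto
  moreover have "(\<Prod>j\<in>I. \<integral>t. v t * poly (p j) t \<partial>M)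
      = (\<Prod>j\<in>I. \<Sum>l\<in>L. poly (p j) (y l) * u l)"
    using prod exact by (intro prod.cong) auto
  moreover have "\<dots> = (\<Sum>l\<in>I \<rightarrow>\<^sub>E L. \<Prod>j\<in>I. poly (p j) (y (l j)) * u (l j))"
    using fin L by (rule prod_sum_PiE)
  ultimately show ?case by (simp add: prod.distrib)
next
  case (scale g c)
  have "(\<lambda>x. (\<Prod>j\<in>I. v (x j)) * (c * g x)) = (\<lambda>x. c * ((\<Prod>j\<in>I. v (x j)) * g x))"
    by (simp add: mult.left_commute)
  then show ?case
    using scale.IH by (simp add: sum_distrib_left mult.assoc)
next
  case (add g h)
  then show ?case
    by (simp add: distrib_left distrib_right sum.distrib)
qed

text \<open>Completion keeps the Borel sets and their measures, so a countable cover for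
  \<open>lborel\<close> serves again.\<close>

lemma sigma_finite_lebesgue: "sigma_finite_measure (lebesgue :: 'a::euclidean_space measure)"
proof
  obtain A :: "'a set set" where "countable A" "A \<subseteq> sets lborel" "\<Union>A = space lborel"
      "\<forall>a\<in>A. emeasure lborel a \<noteq> \<infinity>"
    using lborel.sigma_finite_countable by blast
  then show "\<exists>A::'a set set. countable A \<and> A \<subseteq> sets lebesgue \<and> \<Union>A = space lebesgue \<and>
      (\<forall>a\<in>A. emeasure lebesgue a \<noteq> \<infinity>)"
    by (intro exI[of _ A]) (auto simp: emeasure_completion)
qed

section \<open>Partitions in a box and injections\<close>

text \<open>Adding the staircase (n-1, ..., 1, 0) turns weakly decreasing sequences into strictly
  decreasing ones. The values are the node indices in \<open>cub_node\<close> and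
  \<open>cub_weight\<close>.\<close>

definition staircase_shift :: "nat \<Rightarrow> (nat \<Rightarrow> nat) \<Rightarrow> nat \<Rightarrow> nat" where
  "staircase_shift n la = (\<lambda>j\<in>{1..n}. la j + (n - j))"

lemma staircase_shift_less:
  assumes la: "la \<in> partitions_box m n" and "1 \<le> j" "j < k" "k \<le> n"
  shows "staircase_shift n la k < staircase_shift n la j"
proof -
  have "k \<le> n \<longrightarrow> la k \<le> la j" using less_imp_le[OF \<open>j < k\<close>]
  proof (induction k rule: dec_induct)
    case (step i)
    have "Suc i \<le> n \<Longrightarrow> la (Suc i) \<le> la i"
      using la step \<open>1 \<le> j\<close> by (auto simp: partitions_box_def)
    with step show ?case by auto
  qed simp
  with assms show ?thesis by (auto simp: staircase_shift_def)
qed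

lemma staircase_shift_inj_on:
  assumes "la \<in> partitions_box m n"
  shows "inj_on (staircase_shift n la) {1..n}"
  using staircase_shift_less[OF assms]
  by (intro linorder_inj_onI) (metis atLeastAtMost_iff less_irrefl, linarith)

lemma staircase_shift_in:
  assumes "la \<in> partitions_box m n"
  shows "staircase_shift n la \<in> {1..n} \<rightarrow>\<^sub>E {..<m + n}"
proof (rule PiE_I)
  fix j assume j: "j \<in> {1..n}"
  then have "la j \<le> m" using assms by (auto simp: partitions_box_def)
  with j show "staircase_shift n la j \<in> {..<m + n}" by (auto simp: staircase_shift_def)
qed (auto simp only: staircase_shift_def restrict_apply if_False)

text \<open>The values above the \<open>j\<close>-th one are the first \<open>j - 1\<close> ones, so the image determines the
  enumeration.\<close>

lemma staircase_shift_rank: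
  assumes "la \<in> partitions_box m n" "j \<in> {1..n}"
  shows "card {a \<in> staircase_shift n la ` {1..n}. staircase_shift n la j < a} = j - 1"
proof -
  let ?s = "staircase_shift n la"
  have "{a \<in> ?s ` {1..n}. ?s j < a} = ?s ` {1..<j}"
  proof (intro equalityI subsetI)
    fix a assume "a \<in> {a \<in> ?s ` {1..n}. ?s j < a}"
    then obtain i where i: "i \<in> {1..n}" "a = ?s i" "?s j < ?s i" by auto
    have "i < j"
    proof (rule ccontr)
      assume "\<not> i < j"
      with i assms(2) staircase_shift_less[OF assms(1), of j i] show False
        by (cases "i = j") auto
    qed
    with i show "a \<in> ?s ` {1..<j}" by auto
  next
    fix a assume "a \<in> ?s ` {1..<j}"
    then show "a \<in> {a \<in> ?s ` {1..n}. ?s j < a}"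
      using staircase_shift_less[OF assms(1)] assms(2) by auto
  qed
  moreover have "inj_on ?s {1..<j}"
    using staircase_shift_inj_on[OF assms(1)] by (rule inj_on_subset) (use assms(2) in auto)
  ultimately show ?thesis by (simp add: card_image)
qed

text \<open>If the images agree, the \<open>j\<close>-th value of one enumeration is the
  \<open>k\<close>-th of the other. Its rank in the common image is both \<open>j - 1\<close> and
  \<open>k - 1\<close>, hence \<open>j = k\<close> and the shift cancels.\<close>

lemma staircase_shift_image_inj:
  assumes "la \<in> partitions_box m n" "mu \<in> partitions_box m' n"
    and eq: "staircase_shift n la ` {1..n} = staircase_shift n mu ` {1..n}"
  shows "la = mu"
proof
  fix j
  show "la j = mu j"
  proof (cases "j \<in> {1..n}")
    case True
    then obtain k where k: "k \<in> {1..n}" "staircase_shift n la j = staircase_shift n mu k"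
      using eq by (metis imageE imageI)
    have "j - 1 = k - 1"
      using staircase_shift_rank[OF assms(1) True] staircase_shift_rank[OF assms(2) k(1)] k(2) eq
      by simp
    with True k have "j = k" by auto
    with k(2) True have "la j + (n - j) = mu j + (n - j)"
      by (simp only: staircase_shift_def restrict_apply if_True)
    then show ?thesis by (rule add_right_imp_eq)
  next
    case False
    with assms(1,2) show ?thesis
      by (auto simp: partitions_box_def PiE_iff extensional_def)
  qed
qed

text \<open>List the set in decreasing order and subtract the staircase; strict decrease of integers
  leaves a weakly decreasing sequence.\<close>

lemma staircase_shift_image_surj:
  assumes A: "A \<subseteq> {..<m + n}" "card A = n"
  shows "\<exists>la\<in>partitions_box m n. staircase_shift n la ` {1..n} = A"
proof -
  have finA: "finite A" using A(1) finite_subset by blast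
  define xs where "xs = sorted_list_of_set A"
  have xs: "set xs = A" "length xs = n" "sorted_wrt (<) xs"
    using finA A(2) by (auto simp: xs_def strict_sorted_iff)
  \<comment> \<open>Strictly increasing natural numbers grow by at least one per index.\<close>
  have gap: "xs ! i + (k - i) \<le> xs ! k" if "i \<le> k" "k < n" for i k
    using that
  proof (induction k rule: dec_induct)
    case (step k)
    have "xs ! k < xs ! Suc k"
      using xs step by (intro sorted_wrt_nth_less[OF xs(3)]) auto
    with step show ?case by auto
  qed simp
  \<comment> \<open>This makes the truncated subtraction in \<open>la\<close> below exact, so that
    adding the staircase undoes it.\<close>
  have ge: "i \<le> xs ! i" if "i < n" for i
    using gap[of 0 i] that by simp
  \<comment> \<open>The last entry is at most \<open>m + n - 1\<close>, and entry \<open>i\<close>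
    lies at least \<open>n - 1 - i\<close> below it.\<close>
  have le: "xs ! i - i \<le> m" if "i < n" for i
  proof -
    have "xs ! (n - 1) \<in> A" using that xs nth_mem[of "n - 1" xs] by auto
    then have "xs ! (n - 1) < m + n" using A by auto
    moreover have "xs ! i + (n - 1 - i) \<le> xs ! (n - 1)" using gap[of i "n - 1"] that by simp
    ultimately show ?thesis using that by linarith
  qed
  \<comment> \<open>Since \<open>xs\<close> is increasing and indexed from 0,
    \<open>xs ! (n - j)\<close> is the \<open>j\<close>-th largest element of
    \<open>A\<close>.\<close>
  define la where "la = (\<lambda>j\<in>{1..n}. xs ! (n - j) - (n - j))"
  have "la \<in> partitions_box m n"
    unfolding partitions_box_def
  proof (intro CollectI conjI ballI)
    show "la \<in> {1..n} \<rightarrow>\<^sub>E {0..m}"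
    proof (rule PiE_I)
      fix j assume "j \<in> {1..n}"
      then show "la j \<in> {0..m}" using le[of "n - j"] by (simp add: la_def del: diff_diff_left)
    qed (auto simp only: la_def restrict_apply if_False)
  next
    fix j assume j: "j \<in> {1..<n}"
    then have "xs ! (n - (j + 1)) + 1 \<le> xs ! (n - j)"
      using gap[of "n - (j + 1)" "n - j"] by auto
    with j show "la (j + 1) \<le> la j" by (auto simp: la_def)
  qed
  moreover have "staircase_shift n la ` {1..n} = (\<lambda>j. xs ! (n - j)) ` {1..n}"
  proof (intro image_cong refl)
    fix j assume "j \<in> {1..n}"
    then show "staircase_shift n la j = xs ! (n - j)"
      using ge[of "n - j"] by (simp add: staircase_shift_def la_def del: diff_diff_left)
  qed
  moreover have "\<dots> = (\<lambda>i. xs ! i) ` {0..<n}"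
  proof -
    have "(\<lambda>j. n - j) ` {1..n} = {0..<n}"
    proof (intro equalityI subsetI)
      fix i assume "i \<in> {0..<n}"
      then have "i = n - (n - i)" "n - i \<in> {1..n}" by auto
      then show "i \<in> (\<lambda>j. n - j) ` {1..n}" by (rule image_eqI)
    qed auto
    then show ?thesis by (metis image_image)
  qed
  moreover have "\<dots> = A" using xs by (metis list.set_map map_nth set_upt)
  ultimately show ?thesis by auto
qed

text \<open>This reduces counting partitions to counting the \<open>n\<close>-element subsets of
  \<open>m + n\<close> indices.\<close>

lemma bij_betw_staircase_shift_image:
  "bij_betw (\<lambda>la. staircase_shift n la ` {1..n}) (partitions_box m n)
     {A. A \<subseteq> {..<m + n} \<and> card A = n}"
proof (rule bij_betwI')
  show "(staircase_shift n la ` {1..n} = staircase_shift n mu ` {1..n}) = (la = mu)"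
    if "la \<in> partitions_box m n" "mu \<in> partitions_box m n" for la mu
    using staircase_shift_image_inj[OF that] by auto
  show "staircase_shift n la ` {1..n} \<in> {A. A \<subseteq> {..<m + n} \<and> card A = n}"
    if "la \<in> partitions_box m n" for la
    using staircase_shift_in[OF that] card_image[OF staircase_shift_inj_on[OF that]] by auto
  show "\<exists>la\<in>partitions_box m n. A = staircase_shift n la ` {1..n}"
    if "A \<in> {A. A \<subseteq> {..<m + n} \<and> card A = n}" for A
    using staircase_shift_image_surj[of A m n] that by auto
qed

lemma card_partitions_box: "card (partitions_box m n) = (m + n) choose n"
  using bij_betw_same_card[OF bij_betw_staircase_shift_image] n_subsets[of "{..<m + n}" n] by simp

text \<open>The image of an injective map determines \<open>la\<close>. The permutation that
  rearranges the decreasing enumeration into the map is then unique because the shifted partition is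
  injective.\<close>

lemma bij_betw_partition_permutation:
  "bij_betw (\<lambda>(la, \<sigma>). staircase_shift n la \<circ> \<sigma>)
     (partitions_box m n \<times> {\<sigma>. \<sigma> permutes {1..n}})
     {l \<in> {1..n} \<rightarrow>\<^sub>E {..<m + n}. inj_on l {1..n}}"
  (is "bij_betw ?g ?P ?T")
proof (rule bij_betwI')
  fix p q assume p: "p \<in> ?P" and q: "q \<in> ?P"
  obtain la \<sigma> where p': "p = (la, \<sigma>)" by fastforce
  obtain mu \<tau> where q': "q = (mu, \<tau>)" by fastforce
  note pq = p' q'
  have perm: "\<sigma> permutes {1..n}" "\<tau> permutes {1..n}"
    and box: "la \<in> partitions_box m n" "mu \<in> partitions_box m n" using p q pq by auto
  show "(?g p = ?g q) = (p = q)"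
  proof
    assume "?g p = ?g q"
    then have eq: "staircase_shift n la \<circ> \<sigma> = staircase_shift n mu \<circ> \<tau>" by (simp add: pq)
    then have "staircase_shift n la ` \<sigma> ` {1..n} = staircase_shift n mu ` \<tau> ` {1..n}"
      by (metis image_comp)
    then have "la = mu"
      using staircase_shift_image_inj[OF box] perm by (simp add: permutes_image)
    have "\<sigma> j = \<tau> j" for j
    proof (cases "j \<in> {1..n}")
      case True
      then show ?thesis
        using inj_onD[OF staircase_shift_inj_on[OF box(1)], of "\<sigma> j" "\<tau> j"] perm
          fun_cong[OF eq, of j] \<open>la = mu\<close> by (simp add: permutes_in_image del: atLeastAtMost_iff)
    next
      case False
      with perm show ?thesis by (metis permutes_not_in)
    qed
    then show "p = q" using \<open>la = mu\<close> pq by auto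
  qed simp
next
  fix p assume p: "p \<in> ?P"
  obtain la \<sigma> where [simp]: "p = (la, \<sigma>)" by fastforce
  have \<sigma>: "\<sigma> permutes {1..n}" and la: "la \<in> partitions_box m n" using p by auto
  have "inj_on (staircase_shift n la \<circ> \<sigma>) {1..n}"
    using \<sigma> la by (intro comp_inj_on)
      (auto simp: permutes_image permutes_inj_on simp del: One_nat_def intro: staircase_shift_inj_on)
  moreover have "staircase_shift n la \<circ> \<sigma> \<in> {1..n} \<rightarrow>\<^sub>E {..<m + n}"
    using staircase_shift_in[OF la] \<sigma> permutes_in_image[OF \<sigma>] permutes_not_in[OF \<sigma>]
    by (auto simp: PiE_iff extensional_def simp del: atLeastAtMost_iff)
  ultimately show "?g p \<in> ?T" by simp
next
  fix l assume l: "l \<in> ?T"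
  then have l': "l \<in> {1..n} \<rightarrow>\<^sub>E {..<m + n}" "inj_on l {1..n}" by auto
  have "card (l ` {1..n}) = n" using card_image[OF l'(2)] by simp
  moreover have "l ` {1..n} \<subseteq> {..<m + n}" using l'(1) by auto
  ultimately obtain la where la: "la \<in> partitions_box m n"
    "staircase_shift n la ` {1..n} = l ` {1..n}"
    using staircase_shift_image_surj by blast
  let ?s = "staircase_shift n la"
  \<comment> \<open>The position of \<open>l j\<close> in the decreasing enumeration;
    \<open>permutes\<close> demands the identity outside \<open>{1..n}\<close>.\<close>
  define \<sigma> where "\<sigma> j = (if j \<in> {1..n} then inv_into {1..n} ?s (l j) else j)" for j
  have s\<sigma>: "?s (\<sigma> j) = l j" if "j \<in> {1..n}" for j
    using that la(2) by (auto simp: \<sigma>_def intro!: f_inv_into_f)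
  have \<sigma>in: "\<sigma> j \<in> {1..n}" if "j \<in> {1..n}" for j
    using that la(2) by (metis \<sigma>_def image_eqI inv_into_into)
  have "inj_on \<sigma> {1..n}"
    using l'(2) s\<sigma> by (metis inj_on_def)
  then have "bij_betw \<sigma> {1..n} {1..n}"
    using \<sigma>in by (intro bij_betw_imageI endo_inj_surj) auto
  then have "\<sigma> permutes {1..n}"
    by (rule bij_imp_permutes) (simp only: \<sigma>_def if_False)
  moreover have "l = ?s \<circ> \<sigma>"
  proof
    fix j show "l j = (?s \<circ> \<sigma>) j"
      using s\<sigma>[of j] l'(1) by (cases "j \<in> {1..n}")
        (auto simp: \<sigma>_def staircase_shift_def PiE_iff extensional_def)
  qed
  ultimately show "\<exists>p\<in>?P. l = ?g p" using la(1) by auto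
qed

text \<open>Non-injective maps contribute nothing, and the injective ones fall into classes, one per
  partition, of \<open>n!\<close> maps with equal summands.\<close>

lemma sum_symmetric_eq_sum_partitions:
  fixes F :: "(nat \<Rightarrow> nat) \<Rightarrow> 'a::{comm_semiring_1,semiring_char_0}"
  assumes sym: "\<And>l \<sigma>. \<sigma> permutes {1..n} \<Longrightarrow> F (l \<circ> \<sigma>) = F l"
    and zero: "\<And>l. \<not> inj_on l {1..n} \<Longrightarrow> F l = 0"
  shows "(\<Sum>l\<in>{1..n} \<rightarrow>\<^sub>E {..<m + n}. F l) =
    fact n * (\<Sum>la\<in>partitions_box m n. F (staircase_shift n la))"
proof -
  have "(\<Sum>l\<in>{1..n} \<rightarrow>\<^sub>E {..<m + n}. F l) = (\<Sum>l\<in>{l \<in> {1..n} \<rightarrow>\<^sub>E {..<m + n}. inj_on l {1..n}}. F l)"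
    using zero by (intro sum.mono_neutral_right) (auto intro: finite_PiE)
  also have "\<dots> = (\<Sum>(la, \<sigma>)\<in>partitions_box m n \<times> {\<sigma>. \<sigma> permutes {1..n}}.
      F (staircase_shift n la \<circ> \<sigma>))"
    by (subst sum.reindex_bij_betw[OF bij_betw_partition_permutation, symmetric])
       (simp add: case_prod_unfold)
  also have "\<dots> = (\<Sum>la\<in>partitions_box m n. \<Sum>\<sigma> | \<sigma> permutes {1..n}. F (staircase_shift n la))"
    by (simp add: sum.cartesian_product[symmetric] sym)
  also have "\<dots> = fact n * (\<Sum>la\<in>partitions_box m n. F (staircase_shift n la))"
    by (simp add: card_permutations[of _ n] sum_distrib_left)
  finally show ?thesis .
qed

section \<open>Symmetry of the integrand\<close>

lemma sym_poly_space_keys: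
  assumes "f \<in> sym_poly_space D n" "\<mu> \<in> Poly_Mapping.keys f"
  shows "Poly_Mapping.keys \<mu> \<subseteq> {1..n}" "\<And>j. Poly_Mapping.lookup \<mu> j \<le> D"
proof -
  show *: "Poly_Mapping.keys \<mu> \<subseteq> {1..n}" using assms by (auto simp: sym_poly_space_def)
  fix j show "Poly_Mapping.lookup \<mu> j \<le> D"
  proof (cases "j \<in> {1..n}")
    case True with assms show ?thesis by (auto simp: sym_poly_space_def)
  next
    case False
    with * have "Poly_Mapping.lookup \<mu> j = 0" by (meson in_keys_iff subsetD)
    then show ?thesis by simp
  qed
qed

text \<open>Padding with factors \<open>x j ^ 0\<close> gives all monomials the same index set, as
  reindexing by a permutation requires.\<close>

lemma mpoly_eval_sym_poly_space:
  assumes "f \<in> sym_poly_space D n"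
  shows "mpoly_eval f x = (\<Sum>\<mu>\<in>Poly_Mapping.keys f.
    Poly_Mapping.lookup f \<mu> * (\<Prod>j\<in>{1..n}. x j ^ Poly_Mapping.lookup \<mu> j))"
  unfolding mpoly_eval_def
proof (intro sum.cong refl arg_cong2[where f = "(*)"])
  fix \<mu> assume "\<mu> \<in> Poly_Mapping.keys f"
  then show "(\<Prod>j\<in>Poly_Mapping.keys \<mu>. x j ^ Poly_Mapping.lookup \<mu> j)
      = (\<Prod>j\<in>{1..n}. x j ^ Poly_Mapping.lookup \<mu> j)"
    using sym_poly_space_keys(1)[OF assms]
    by (intro prod.mono_neutral_left) (auto simp: in_keys_iff)
qed

text \<open>Needed because \<open>cub_node\<close> is restricted to \<open>{1..n}\<close> and may
  differ elsewhere from the composition of \<open>nd\<close> with the shifted partition.\<close>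

lemma mpoly_eval_cong:
  assumes "f \<in> sym_poly_space D n" "\<And>j. j \<in> {1..n} \<Longrightarrow> x j = y j"
  shows "mpoly_eval f x = mpoly_eval f y"
  unfolding mpoly_eval_sym_poly_space[OF assms(1)]
  by (intro sum.cong refl arg_cong2[where f = "(*)"] prod.cong) (simp add: assms(2))

text \<open>Symmetry is given on coefficients. Two reindexings carry it over to values: one of the
  monomials, the other of the factors within each monomial.\<close>

lemma mpoly_eval_permute:
  assumes f: "f \<in> sym_poly_space D n" and \<sigma>: "\<sigma> permutes {1..n}"
  shows "mpoly_eval f (x \<circ> \<sigma>) = mpoly_eval f x"
proof -
  have inj: "inj \<sigma>" using \<sigma> by (rule permutes_inj)
  have \<sigma>': "inv \<sigma> permutes {1..n}" using \<sigma> by (rule permutes_inv)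
  have inj': "inj (inv \<sigma>)" using \<sigma>' by (rule permutes_inj)
  let ?h = "\<lambda>\<tau> \<mu>. Poly_Mapping.map_key \<tau> (\<mu> :: nat \<Rightarrow>\<^sub>0 nat)"
  have lk: "Poly_Mapping.lookup f (?h \<tau> \<mu>) = Poly_Mapping.lookup f \<mu>" if "\<tau> permutes {1..n}" for \<tau> \<mu>
    using f that by (auto simp: sym_poly_space_def symmetric_mpoly_def)
  have hh: "?h (inv \<sigma>) (?h \<sigma> \<mu>) = \<mu>" "?h \<sigma> (?h (inv \<sigma>) \<mu>) = \<mu>" for \<mu>
    using inj inj' \<sigma> by (simp_all add: map_key_compose permutes_inv_o map_key_id[unfolded id_def[symmetric]])
  have "mpoly_eval f (x \<circ> \<sigma>) = (\<Sum>\<mu>\<in>Poly_Mapping.keys f.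
      Poly_Mapping.lookup f (?h \<sigma> \<mu>) * (\<Prod>j\<in>{1..n}. x (\<sigma> j) ^ Poly_Mapping.lookup \<mu> j))"
    by (simp add: mpoly_eval_sym_poly_space[OF f] lk[OF \<sigma>])
  \<comment> \<open>Invariant coefficients make the support of \<open>f\<close> stable under
    \<open>map_key\<close>, so the monomials can be reindexed by the inverse permutation.\<close>
  also have "\<dots> = (\<Sum>\<mu>\<in>Poly_Mapping.keys f.
      Poly_Mapping.lookup f \<mu> * (\<Prod>j\<in>{1..n}. x (\<sigma> j) ^ Poly_Mapping.lookup (?h \<sigma> \<mu>) j))"
    by (rule sum.reindex_bij_witness[where i = "?h \<sigma>" and j = "?h (inv \<sigma>)"])
       (auto simp: hh lk[OF \<sigma>] lk[OF \<sigma>'] in_keys_iff)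
  also have "\<dots> = (\<Sum>\<mu>\<in>Poly_Mapping.keys f.
      Poly_Mapping.lookup f \<mu> * (\<Prod>j\<in>{1..n}. x (\<sigma> j) ^ Poly_Mapping.lookup \<mu> (\<sigma> j)))"
    by (simp add: map_key.rep_eq inj)
  \<comment> \<open>Base and exponent now both depend on \<open>j\<close> through
    \<open>\<sigma> j\<close> alone.\<close>
  also have "\<dots> = (\<Sum>\<mu>\<in>Poly_Mapping.keys f.
      Poly_Mapping.lookup f \<mu> * (\<Prod>j\<in>{1..n}. x j ^ Poly_Mapping.lookup \<mu> j))"
    by (intro sum.cong refl arg_cong2[where f = "(*)"])
       (rule prod.permute[OF \<sigma>, unfolded comp_def, symmetric])
  finally show ?thesis by (simp add: mpoly_eval_sym_poly_space[OF f])
qed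

lemma tensor_poly_mpoly_eval:
  assumes f: "f \<in> sym_poly_space D n"
  shows "tensor_poly {1..n} (\<lambda>_. D) (mpoly_eval f)"
proof -
  have "tensor_poly {1..n} (\<lambda>_. D) (\<lambda>x. \<Sum>\<mu>\<in>Poly_Mapping.keys f. Poly_Mapping.lookup f \<mu> *
      (\<Prod>j\<in>{1..n}. poly (monom 1 (Poly_Mapping.lookup \<mu> j)) (x j)))"
    using sym_poly_space_keys(2)[OF f]
    by (intro tensor_poly_sum tensor_poly.scale tensor_poly.prod) (simp add: degree_monom_eq)
  then show ?thesis
    by (simp add: poly_monom mpoly_eval_sym_poly_space[OF f, abs_def])
qed

text \<open>A product over ordered pairs, in which invariance under permutations is a reindexing.\<close>

lemma vandermonde_sq_eq_prod_abs:
  fixes x :: "nat \<Rightarrow> real"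
  shows "(\<Prod>k\<in>{1..n}. \<Prod>j\<in>{1..<k}. (x j - x k)\<^sup>2)
    = (\<Prod>k\<in>{1..n}. \<Prod>j\<in>{1..n} - {k}. \<bar>x j - x k\<bar>)"
proof -
  have split: "(\<Prod>j\<in>{1..n} - {k}. \<bar>x j - x k\<bar>)
      = (\<Prod>j\<in>{1..<k}. \<bar>x j - x k\<bar>) * (\<Prod>j\<in>{k<..n}. \<bar>x j - x k\<bar>)" if "k \<in> {1..n}" for k
    using that by (subst prod.union_disjoint[symmetric]) (auto intro!: prod.cong)
  \<comment> \<open>Exchanging the two indices maps one triangle of pairs onto the other; the
    absolute values absorb the change of sign.\<close>
  have swap: "(\<Prod>k\<in>{1..n}. \<Prod>j\<in>{k<..n}. \<bar>x j - x k\<bar>) = (\<Prod>k\<in>{1..n}. \<Prod>j\<in>{1..<k}. \<bar>x j - x k\<bar>)"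
    by (subst (1 2) prod.Sigma, simp, simp, simp, simp)
       (rule prod.reindex_bij_witness[where i = prod.swap and j = prod.swap], auto simp: abs_minus_commute)
  have "(\<Prod>k\<in>{1..n}. \<Prod>j\<in>{1..n} - {k}. \<bar>x j - x k\<bar>)
      = (\<Prod>k\<in>{1..n}. \<Prod>j\<in>{1..<k}. \<bar>x j - x k\<bar>) * (\<Prod>k\<in>{1..n}. \<Prod>j\<in>{1..<k}. \<bar>x j - x k\<bar>)"
    by (simp only: split prod.distrib swap cong: prod.cong)
  moreover have "y\<^sup>2 = \<bar>y\<bar> * \<bar>y\<bar>" for y :: real
    by (simp add: power2_eq_square)
  ultimately show ?thesis by (simp only: prod.distrib)
qed

text \<open>In the form over ordered pairs, \<sigma> maps the indices other than \<open>k\<close>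
  onto those other than \<open>\<sigma> k\<close>, and then permutes the outer index.\<close>

lemma vandermonde_sq_permute:
  fixes x :: "nat \<Rightarrow> real"
  assumes \<sigma>: "\<sigma> permutes {1..n}"
  shows "(\<Prod>k\<in>{1..n}. \<Prod>j\<in>{1..<k}. (x (\<sigma> j) - x (\<sigma> k))\<^sup>2)
    = (\<Prod>k\<in>{1..n}. \<Prod>j\<in>{1..<k}. (x j - x k)\<^sup>2)"
proof -
  have "(\<Prod>j\<in>{1..n} - {k}. \<bar>x (\<sigma> j) - x (\<sigma> k)\<bar>) = (\<Prod>j\<in>{1..n} - {\<sigma> k}. \<bar>x j - x (\<sigma> k)\<bar>)" for k
  proof (rule prod.reindex_bij_betw)
    have "\<sigma> ` ({1..n} - {k}) = {1..n} - {\<sigma> k}"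
      using permutes_inj[OF \<sigma>] by (simp add: image_set_diff permutes_image[OF \<sigma>] del: One_nat_def)
    then show "bij_betw \<sigma> ({1..n} - {k}) ({1..n} - {\<sigma> k})"
      using permutes_inj_on[OF \<sigma>] by (simp add: bij_betw_def)
  qed
  then show ?thesis
    unfolding vandermonde_sq_eq_prod_abs[where x = x] vandermonde_sq_eq_prod_abs[where x = "\<lambda>j. x (\<sigma> j)"]
    using prod.permute[OF \<sigma>, of "\<lambda>k. \<Prod>j\<in>{1..n} - {k}. \<bar>x j - x k\<bar>"] by (simp add: comp_def)
qed

text \<open>Using ordered pairs avoids deciding which of two indices with equal values is
  smaller.\<close>

lemma vandermonde_sq_eq_0:
  fixes x :: "nat \<Rightarrow> real"
  assumes "\<not> inj_on x {1..n}"
  shows "(\<Prod>k\<in>{1..n}. \<Prod>j\<in>{1..<k}. (x j - x k)\<^sup>2) = 0"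
proof -
  obtain j k where jk: "j \<in> {1..n}" "k \<in> {1..n}" "x j = x k" "j \<noteq> k"
    using assms by (auto simp: inj_on_def)
  then have "(\<Prod>i\<in>{1..n} - {k}. \<bar>x i - x k\<bar>) = 0" by (auto intro!: prod_zero)
  then have "\<exists>k\<in>{1..n}. (\<Prod>i\<in>{1..n} - {k}. \<bar>x i - x k\<bar>) = 0" using jk(2) by blast
  then show ?thesis
    unfolding vandermonde_sq_eq_prod_abs by (intro prod_zero) auto
qed

section \<open>The cubature rule\<close>

text \<open>A polynomial moment is a linear combination of power moments. The indicator is absorbed
  into the weight so that the tensor rule can be applied with Lebesgue measure on the whole
  line.\<close>

lemma interval_integrable_poly:
  assumes "weight_function a b w" "a \<le> b"
  shows "integrable lebesgue (\<lambda>t. (indicator (einterval a b) t * w t) * poly p t)"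
proof -
  have "integrable lebesgue (\<lambda>t. indicator (einterval a b) t * (t ^ k * w t))" for k
    using assms
    by (simp add: weight_function_def interval_lebesgue_integrable_def set_integrable_def)
  then have "integrable lebesgue
      (\<lambda>t. \<Sum>k\<le>degree p. coeff p k * (indicator (einterval a b) t * (t ^ k * w t)))"
    by (intro Bochner_Integration.integrable_sum integrable_mult_right)
  also have "(\<lambda>t. \<Sum>k\<le>degree p. coeff p k * (indicator (einterval a b) t * (t ^ k * w t)))
      = (\<lambda>t. (indicator (einterval a b) t * w t) * poly p t)"
    by (simp add: poly_altdef sum_distrib_left mult_ac)
  finally show ?thesis .
qed

theorem proposition1:
  fixes n m \<delta> :: nat
    and a b :: ereal
    and w :: "real \<Rightarrow> real"
    and nd wt :: "nat \<Rightarrow> nat \<Rightarrow> real"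
    and f :: mpoly_real
  assumes "n \<ge> 1"
    and "2 * m + 1 \<ge> \<delta>"
    and "a < b"
    and "weight_function a b w"
    and "quadrature_rules a b w \<delta> nd wt"
    and "f \<in> sym_poly_space (2 * m + 1 - \<delta>) n"
  shows "set_integrable (Pi\<^sub>M {1..n} (\<lambda>_. lebesgue)) ({1..n} \<rightarrow>\<^sub>E einterval a b)
           (\<lambda>x. mpoly_eval f x * W_density w n x)
       \<and> 1 / fact n *
           (LINT x : ({1..n} \<rightarrow>\<^sub>E einterval a b) | Pi\<^sub>M {1..n} (\<lambda>_. lebesgue).
              (mpoly_eval f x * W_density w n x))
         = (\<Sum>la\<in>partitions_box m n.
              mpoly_eval f (cub_node nd m n la) * cub_weight nd wt m n la)
       \<and> card (partitions_box m n) = (m + n) choose n"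
proof -
  let ?V = "\<lambda>x::nat \<Rightarrow> real. \<Prod>k\<in>{1..n}. \<Prod>j\<in>{1..<k}. (x j - x k)\<^sup>2"
  let ?v = "\<lambda>t. indicator (einterval a b) t * w t"
  let ?P = "Pi\<^sub>M {1..n} (\<lambda>_. lebesgue :: real measure)"
  \<comment> \<open>The degree bound of \<open>f\<close> plus that of the squared Vandermonde
    product. It equals the exactness degree of the rule with \<open>N = m + n\<close> nodes, which
    is the case \<open>M = m + n - 1\<close>.\<close>
  define D where "D = 2 * m + 1 - \<delta> + 2 * (n - 1)"
  define N where "N = m + n"
  have N: "N = (m + n - 1) + 1" and D: "D = 2 * (m + n - 1) + 1 - \<delta>"
    and le: "\<delta> \<le> 2 * (m + n - 1) + 1"
    using \<open>n \<ge> 1\<close> \<open>2 * m + 1 \<ge> \<delta>\<close> by (auto simp: N_def D_def)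
  have sets: "{0..m + n - 1} = {..<N}" using N by auto
  have exact: "(\<integral>t. ?v t * poly p t \<partial>lebesgue) = (\<Sum>l<N. poly p (nd N l) * wt N l)"
    if "degree p \<le> D" for p
  proof -
    have "(LINT x=a..b|lebesgue. (poly p x * w x)) = (\<Sum>l<N. poly p (nd N l) * wt N l)"
      using assms(5) le that unfolding quadrature_rules_def D sets[symmetric] by (metis N)
    moreover have "(LINT x=a..b|lebesgue. (poly p x * w x)) = (\<integral>t. ?v t * poly p t \<partial>lebesgue)"
      using \<open>a < b\<close>
      by (simp add: interval_lebesgue_integral_def set_lebesgue_integral_def mult_ac)
    ultimately show ?thesis by simp
  qed
  \<comment> \<open>Points of the product space are undefined outside \<open>{1..n}\<close>. For
    them the product of the one-variable indicators is the indicator of the cube.\<close>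
  have integrand: "(\<Prod>j\<in>{1..n}. ?v (x j)) * (mpoly_eval f x * ?V x)
      = indicator ({1..n} \<rightarrow>\<^sub>E einterval a b) x *\<^sub>R (mpoly_eval f x * W_density w n x)"
    if "x \<in> space ?P" for x
  proof -
    have "(\<Prod>j\<in>{1..n}. indicator (einterval a b) (x j)) =
        (indicator ({1..n} \<rightarrow>\<^sub>E einterval a b) x :: real)"
      using that by (auto simp: space_PiM indicator_def PiE_iff intro: prod.neutral)
    then show ?thesis by (simp add: W_density_def prod.distrib mult_ac)
  qed
  have "tensor_poly {1..n} (\<lambda>_. D) (\<lambda>x. mpoly_eval f x * ?V x)"
    unfolding D_def
    by (rule tensor_poly_mult[OF tensor_poly_mpoly_eval[OF assms(6)] tensor_poly_vandermonde_sq])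
  from tensor_quadrature[OF sigma_finite_lebesgue _ this, where v = ?v and L = "{..<N}" and y = "nd N" and u = "wt N"]
  have int: "integrable ?P (\<lambda>x. (\<Prod>j\<in>{1..n}. ?v (x j)) * (mpoly_eval f x * ?V x))"
    and rule: "(\<integral>x. (\<Prod>j\<in>{1..n}. ?v (x j)) * (mpoly_eval f x * ?V x) \<partial>?P) =
      (\<Sum>l\<in>{1..n} \<rightarrow>\<^sub>E {..<N}. mpoly_eval f (\<lambda>j. nd N (l j)) * ?V (\<lambda>j. nd N (l j)) *
        (\<Prod>j\<in>{1..n}. wt N (l j)))"
    using interval_integrable_poly[OF assms(4)] exact \<open>a < b\<close> by auto
  have "set_integrable ?P ({1..n} \<rightarrow>\<^sub>E einterval a b) (\<lambda>x. mpoly_eval f x * W_density w n x)"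
    unfolding set_integrable_def
    using int by (rule iffD1[OF Bochner_Integration.integrable_cong[OF refl integrand], rotated])
  moreover have "(LINT x : ({1..n} \<rightarrow>\<^sub>E einterval a b) | ?P. (mpoly_eval f x * W_density w n x))
      = fact n * (\<Sum>la\<in>partitions_box m n.
          mpoly_eval f (cub_node nd m n la) * cub_weight nd wt m n la)"
  proof -
    define F where "F l = mpoly_eval f (\<lambda>j. nd N (l j)) * ?V (\<lambda>j. nd N (l j)) *
        (\<Prod>j\<in>{1..n}. wt N (l j))" for l
    have "(LINT x : ({1..n} \<rightarrow>\<^sub>E einterval a b) | ?P. (mpoly_eval f x * W_density w n x))
        = (\<Sum>l\<in>{1..n} \<rightarrow>\<^sub>E {..<m + n}. F l)"
      unfolding set_lebesgue_integral_def F_def N_def[symmetric] rule[symmetric]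
      by (intro Bochner_Integration.integral_cong refl) (simp only: integrand)
    also have "\<dots> = fact n * (\<Sum>la\<in>partitions_box m n. F (staircase_shift n la))"
    proof (rule sum_symmetric_eq_sum_partitions)
      show "F (l \<circ> \<sigma>) = F l" if "\<sigma> permutes {1..n}" for l \<sigma>
        using mpoly_eval_permute[OF assms(6) that, of "\<lambda>j. nd N (l j)"]
          vandermonde_sq_permute[OF that, of "\<lambda>j. nd N (l j)"]
          prod.permute[OF that, of "\<lambda>j. wt N (l j)"]
        by (simp add: F_def comp_def)
      show "F l = 0" if "\<not> inj_on l {1..n}" for l
      proof -
        \<comment> \<open>A repeated index gives a repeated node, so the squared Vandermonde factor
          vanishes.\<close>
        have "\<not> inj_on (\<lambda>j. nd N (l j)) {1..n}"
          using that inj_on_imageI2[of "nd N" l] by (auto simp: comp_def)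
        from vandermonde_sq_eq_0[OF this] show ?thesis by (simp add: F_def)
      qed
    qed
    finally have "(LINT x : ({1..n} \<rightarrow>\<^sub>E einterval a b) | ?P. (mpoly_eval f x * W_density w n x))
        = fact n * (\<Sum>la\<in>partitions_box m n. F (staircase_shift n la))" .
    moreover have "F (staircase_shift n la)
        = mpoly_eval f (cub_node nd m n la) * cub_weight nd wt m n la" for la
    proof -
      have "mpoly_eval f (\<lambda>j. nd N (staircase_shift n la j)) = mpoly_eval f (cub_node nd m n la)"
        by (intro mpoly_eval_cong[OF assms(6)]) (simp add: cub_node_def staircase_shift_def N_def)
      moreover have "?V (\<lambda>j. nd N (staircase_shift n la j)) *
          (\<Prod>j\<in>{1..n}. wt N (staircase_shift n la j)) = cub_weight nd wt m n la"
        unfolding cub_weight_def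
        by (intro arg_cong2[where f = "(*)"] prod.cong refl) (auto simp: staircase_shift_def N_def)
      ultimately show ?thesis by (simp add: F_def mult.assoc)
    qed
    ultimately show ?thesis by simp
  qed
  ultimately show ?thesis by (simp add: card_partitions_box)
qed

end
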